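(* Let $C\in\mathcal C_1^\star$ be a cluster containing at least two atoms, where $\mathcal C_1^\star$ is a regular atom-respecting clustering. For distinct atoms $A,B\subseteq C$, $$w(A,B)<32\,\frac{d_C(A)\,d_C(B)}{\mathrm{vol}_C}.$$
   Context: Instance: a set $V$ of $n\ge2$ vertices; $\binom V2=E^+\uplus E^-$ (positive/negative pairs, arbitrary); weights $w_{uv}=w_{vu}\ge0$, $w_{uu}=0$, $w_{uv}\le w_{ua}+w_{av}$ for all $u,v,a\in V$. For a partition (clustering) $\mathcal C$ of $V$, $\operatorname{obj}(\mathcal C)$ is the total weight of positive pairs whose endpoints lie in different parts plus the total weight of negative pairs whose endpoints lie in the same part; $\mathrm{OPT}=\min_{\mathcal C}\operatorname{obj}(\mathcal C)$. For $A,B\subseteq V$, $w(A,B)=\sum_{a\in A}\sum_{b\in B}w_{ab}$; $w^+(A,B)$ is the same sum restricted to positive pairs; $w(u,A)=w(\{u\},A)$. $N_u^+=\{v\ne u:uv\in E^+\}$. Atoms. Fix an absolute constant $\beta$ with $0<\beta\le\frac{2\sqrt7-5}{6}$ and a clustering $\mathcal C^0$ with $\operatorname{obj}(\mathcal C^0)\le\frac{20}3\mathrm{OPT}$. For $u\in C\in\mathcal C^0$ put $\delta_C(u)=w(u,N_u^+\triangle C)$ and $M_C=\{u\in C:\delta_C(u)>\frac\beta2w(u,C)\}$. The atom partition $\mathcal K$ is obtained by processing each $C\in\mathcal C^0$: if $\sum_{u\in M_C}\delta_C(u)>\frac{\beta^2}{20}w(C,C)$, put every singleton $\{u\}$, $u\in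 C$, in $\mathcal K$; otherwise put $\{u\}$ in $\mathcal K$ for each $u\in M_C$, and also $C\setminus M_C$ if nonempty. $\alpha\ge1$ is a fixed absolute constant (depending only on $\beta$) such that $\operatorname{obj}(\mathcal K)\le\alpha\,\mathrm{OPT}$ always holds. Regular clustering. Let $\varepsilon\in(0,1]$. For unions $X,Y$ of atoms let $w^+_{\mathcal K}(X,Y)=\sum w^+(K,L)$ over $K,L\in\mathcal K$ with $K\subseteq X$, $L\subseteq Y$, $K\ne L$. $\mathcal C_1^\star$ is a clustering such that each atom is contained in one of its parts (atom-respecting), its cost is at most $(1+\varepsilon)\mathrm{OPT}$, and for each $C\in\mathcal C_1^\star$: (R1) for every partition $S\uplus T=C$ into two nonempty unions of atoms, $w^+(S,T)>\frac12w(S,T)$; (R2) for every atom $K\subsetneq C$, $w^+_{\mathcal K}(K,C)>\frac{\varepsilon}{2\alpha}w^+_{\mathcal K}(K,V)$. For $C\in\mathcal C_1^\star$ with at least two atoms and an atom $K\subseteq C$: $d_C(K)=\sum_{L}w^+(K,L)$ over atoms $L\subseteq C$, $L\ne K$; $\mathrm{vol}_C=\sum_{K\in\mathcal K,\,K\subseteq C}d_C(K)$ (which is positive). *)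

theory Defs
  imports Complex_Main "HOL-Library.Disjoint_Sets"
begin

text \<open>
  Metric-weighted correlation clustering. Unordered pairs of vertices are two-element sets;
  a clustering of \<open>V\<close> is a partition in the sense of \<^const>\<open>partition_on\<close>.
\<close>

locale cc_instance =
  fixes V :: "'a set" and Ep Em :: "'a set set" and w :: "'a \<Rightarrow> 'a \<Rightarrow> real"
  assumes finite_V: "finite V"
    and two_le_card_V: "2 \<le> card V"
    and pairs: "Ep \<union> Em = {e. e \<subseteq> V \<and> card e = 2}"
    and signs_disjoint: "Ep \<inter> Em = {}"
    and w_nonneg: "\<lbrakk>u \<in> V; v \<in> V\<rbrakk> \<Longrightarrow> 0 \<le> w u v"
    and w_sym: "\<lbrakk>u \<in> V; v \<in> V\<rbrakk> \<Longrightarrow> w u v = w v u"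
    and w_self: "u \<in> V \<Longrightarrow> w u u = 0"
    and w_triangle: "\<lbrakk>u \<in> V; v \<in> V; a \<in> V\<rbrakk> \<Longrightarrow> w u v \<le> w u a + w a v"

text \<open>
  The weight of a pair \<open>e = {u, v}\<close>: the double sum counts \<open>w u v\<close> and \<open>w v u\<close>, and the diagonal
  vanishes (see \<open>pair_weight_eq\<close> below).
\<close>

definition pair_weight :: "('a \<Rightarrow> 'a \<Rightarrow> real) \<Rightarrow> 'a set \<Rightarrow> real" where
  "pair_weight w e = (\<Sum>u\<in>e. \<Sum>v\<in>e. w u v) / 2"

lemma (in cc_instance) pair_weight_eq:
  assumes "u \<in> V" "v \<in> V" "u \<noteq> v"
  shows "pair_weight w {u, v} = w u v"
  using assms w_sym[of u v] w_self by (simp add: pair_weight_def)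

definition obj ::
  "'a set set \<Rightarrow> 'a set set \<Rightarrow> ('a \<Rightarrow> 'a \<Rightarrow> real) \<Rightarrow> 'a set set \<Rightarrow> real" where
  "obj Ep Em w P =
     (\<Sum>e\<in>{e \<in> Ep. \<not> (\<exists>C\<in>P. e \<subseteq> C)}. pair_weight w e)
   + (\<Sum>e\<in>{e \<in> Em. \<exists>C\<in>P. e \<subseteq> C}. pair_weight w e)"

definition opt ::
  "'a set \<Rightarrow> 'a set set \<Rightarrow> 'a set set \<Rightarrow> ('a \<Rightarrow> 'a \<Rightarrow> real) \<Rightarrow> real" where
  "opt V Ep Em w = Min (obj Ep Em w ` {P. partition_on V P})"

definition weight :: "('a \<Rightarrow> 'a \<Rightarrow> real) \<Rightarrow> 'a set \<Rightarrow> 'a set \<Rightarrow> real" where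
  "weight w A B = (\<Sum>a\<in>A. \<Sum>b\<in>B. w a b)"

definition pos_weight ::
  "'a set set \<Rightarrow> ('a \<Rightarrow> 'a \<Rightarrow> real) \<Rightarrow> 'a set \<Rightarrow> 'a set \<Rightarrow> real" where
  "pos_weight Ep w A B = (\<Sum>a\<in>A. \<Sum>b\<in>{b \<in> B. {a, b} \<in> Ep}. w a b)"

definition pos_nbrs :: "'a set set \<Rightarrow> 'a \<Rightarrow> 'a set" where
  "pos_nbrs Ep u = {v. v \<noteq> u \<and> {u, v} \<in> Ep}"

definition disagreement ::
  "'a set set \<Rightarrow> ('a \<Rightarrow> 'a \<Rightarrow> real) \<Rightarrow> 'a set \<Rightarrow> 'a \<Rightarrow> real" where
  "disagreement Ep w C u = weight w {u} (sym_diff (pos_nbrs Ep u) C)"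

definition marked ::
  "real \<Rightarrow> 'a set set \<Rightarrow> ('a \<Rightarrow> 'a \<Rightarrow> real) \<Rightarrow> 'a set \<Rightarrow> 'a set" where
  "marked \<beta> Ep w C = {u \<in> C. disagreement Ep w C u > \<beta> / 2 * weight w {u} C}"

definition cluster_atoms ::
  "real \<Rightarrow> 'a set set \<Rightarrow> ('a \<Rightarrow> 'a \<Rightarrow> real) \<Rightarrow> 'a set \<Rightarrow> 'a set set" where
  "cluster_atoms \<beta> Ep w C =
     (let M = marked \<beta> Ep w C in
      if (\<Sum>u\<in>M. disagreement Ep w C u) > \<beta>\<^sup>2 / 20 * weight w C C
      then (\<lambda>u. {u}) ` C
      else (\<lambda>u. {u}) ` M \<union> ({C - M} - {{}}))"

definition atoms ::
  "real \<Rightarrow> 'a set set \<Rightarrow> ('a \<Rightarrow> 'a \<Rightarrow> real) \<Rightarrow> 'a set set \<Rightarrow> 'a set set" where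
  "atoms \<beta> Ep w C0 = (\<Union>C\<in>C0. cluster_atoms \<beta> Ep w C)"

text \<open>
  \<open>\<alpha>\<close> is an absolute constant for \<open>\<beta>\<close>: the bound holds for all instances and all starting
  clusterings. Every finite instance is isomorphic to one with vertices in \<^typ>\<open>nat\<close>, so it
  suffices to quantify over those.
\<close>

definition atom_cost_constant :: "real \<Rightarrow> real \<Rightarrow> bool" where
  "atom_cost_constant \<beta> \<alpha> \<longleftrightarrow>
     1 \<le> \<alpha> \<and>
     (\<forall>(V :: nat set) Ep Em w C0.
        cc_instance V Ep Em w \<longrightarrow> partition_on V C0 \<longrightarrow>
        obj Ep Em w C0 \<le> 20 / 3 * opt V Ep Em w \<longrightarrow>
        obj Ep Em w (atoms \<beta> Ep w C0) \<le> \<alpha> * opt V Ep Em w)"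

text \<open>In the following definitions \<open>K\<close> is the atom partition.\<close>

definition atom_union :: "'a set set \<Rightarrow> 'a set \<Rightarrow> bool" where
  "atom_union K X \<longleftrightarrow> (\<exists>F\<subseteq>K. X = \<Union>F)"

definition atom_pos_weight ::
  "'a set set \<Rightarrow> 'a set set \<Rightarrow> ('a \<Rightarrow> 'a \<Rightarrow> real) \<Rightarrow> 'a set \<Rightarrow> 'a set \<Rightarrow> real" where
  "atom_pos_weight K Ep w X Y =
     (\<Sum>A\<in>{A \<in> K. A \<subseteq> X}. \<Sum>B\<in>{B \<in> K. B \<subseteq> Y \<and> A \<noteq> B}. pos_weight Ep w A B)"

definition regular_clustering ::
  "'a set \<Rightarrow> 'a set set \<Rightarrow> 'a set set \<Rightarrow> ('a \<Rightarrow> 'a \<Rightarrow> real) \<Rightarrow> 'a set set \<Rightarrow> real \<Rightarrow> real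
   \<Rightarrow> 'a set set \<Rightarrow> bool" where
  "regular_clustering V Ep Em w K \<alpha> \<epsilon> P \<longleftrightarrow>
     partition_on V P \<and>
     (\<forall>A\<in>K. \<exists>C\<in>P. A \<subseteq> C) \<and>
     obj Ep Em w P \<le> (1 + \<epsilon>) * opt V Ep Em w \<and>
     (\<forall>C\<in>P.
        (\<forall>S T. S \<union> T = C \<and> S \<inter> T = {} \<and> S \<noteq> {} \<and> T \<noteq> {} \<and> atom_union K S \<and> atom_union K T
           \<longrightarrow> pos_weight Ep w S T > 1 / 2 * weight w S T) \<and>
        (\<forall>A\<in>K. A \<subset> C
           \<longrightarrow> atom_pos_weight K Ep w A C > \<epsilon> / (2 * \<alpha>) * atom_pos_weight K Ep w A V))"

definition atom_degree ::
  "'a set set \<Rightarrow> 'a set set \<Rightarrow> ('a \<Rightarrow> 'a \<Rightarrow> real) \<Rightarrow> 'a set \<Rightarrow> 'a set \<Rightarrow> real" where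
  "atom_degree K Ep w C A = (\<Sum>L\<in>{L \<in> K. L \<subseteq> C \<and> L \<noteq> A}. pos_weight Ep w A L)"

definition cluster_vol ::
  "'a set set \<Rightarrow> 'a set set \<Rightarrow> ('a \<Rightarrow> 'a \<Rightarrow> real) \<Rightarrow> 'a set \<Rightarrow> real" where
  "cluster_vol K Ep w C = (\<Sum>A\<in>{A \<in> K. A \<subseteq> C}. atom_degree K Ep w C A)"

end

(*
  Let D(X) = w(X, C - X), and let m, p, q be the sizes of C, A, B. Averaging the triangle inequality
  through the points of C gives m w(A,B) <= q D(A) + p D(B); averaging it through the points of A
  gives p vol_C <= 2 m D(A), and similarly q vol_C <= 2 m D(B). Multiplying out,
  w(A,B) vol_C <= 4 D(A) D(B), and (R1) for the splits {A, C - A} and {B, C - B} gives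
  D(A) < 2 d_C(A) and D(B) < 2 d_C(B). This yields the bound even with 16 in place of 32.
*)

theory Submission
  imports Defs
begin

section \<open>Additivity of weights over disjoint unions\<close>

lemma weight_Un_right:
  assumes "finite Y" "finite Z" "Y \<inter> Z = {}"
  shows "weight w X (Y \<union> Z) = weight w X Y + weight w X Z"
  using assms by (simp add: weight_def sum.union_disjoint sum.distrib)

lemma weight_Union_left:
  assumes "\<And>L. L \<in> F \<Longrightarrow> finite L" "disjoint F"
  shows "weight w (\<Union>F) X = (\<Sum>L\<in>F. weight w L X)"
  unfolding weight_def using assms
  by (subst sum.Union_disjoint) (auto simp: disjoint_def)

lemma pos_weight_Union_right:
  assumes "finite F" "\<And>L. L \<in> F \<Longrightarrow> finite L" "disjoint F"
  shows "pos_weight Ep w X (\<Union>F) = (\<Sum>L\<in>F. pos_weight Ep w X L)"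
proof -
  \<comment> \<open>With the restriction to positive pairs moved into the summand, the index set is
    \<open>Y\<close> itself, so the sum over a disjoint union splits.\<close>
  have eq: "pos_weight Ep w X Y = (\<Sum>a\<in>X. \<Sum>b\<in>Y. if {a, b} \<in> Ep then w a b else 0)"
    if "finite Y" for Y
    using that by (simp add: pos_weight_def sum.inter_filter)
  have "pos_weight Ep w X (\<Union>F)
      = (\<Sum>a\<in>X. \<Sum>L\<in>F. \<Sum>b\<in>L. if {a, b} \<in> Ep then w a b else 0)"
    using assms by (subst eq) (auto simp: sum.Union_disjoint disjoint_def)
  also have "\<dots> = (\<Sum>L\<in>F. pos_weight Ep w X L)"
    using assms(2) by (subst sum.swap) (simp add: eq)
  finally show ?thesis .
qed

section \<open>The atoms as a partition\<close>

lemma partition_on_cluster_atoms: "partition_on C (cluster_atoms \<beta> Ep w C)"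
  by (auto simp: partition_on_def cluster_atoms_def Let_def marked_def disjoint_def)

lemma partition_on_atoms:
  assumes "partition_on V C0"
  shows "partition_on V (atoms \<beta> Ep w C0)"
proof -
  have part: "partition_on C (cluster_atoms \<beta> Ep w C)" if "C \<in> C0" for C
    by (rule partition_on_cluster_atoms)
  show ?thesis
  proof (rule partition_onI)
    show "\<Union>(atoms \<beta> Ep w C0) = V"
      using part assms unfolding atoms_def partition_on_def by blast
  next
    show "{} \<notin> atoms \<beta> Ep w C0"
      using part unfolding atoms_def partition_on_def by blast
  next
    fix p q assume "p \<in> atoms \<beta> Ep w C0" "q \<in> atoms \<beta> Ep w C0" "p \<noteq> q"
    then obtain X Y where XY: "X \<in> C0" "Y \<in> C0" "p \<in> cluster_atoms \<beta> Ep w X"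
      "q \<in> cluster_atoms \<beta> Ep w Y"
      unfolding atoms_def by blast
    show "disjnt p q"
    \<comment> \<open>Two atoms of one cluster are separated by its own atom partition; atoms of
      different clusters lie in disjoint parts of \<open>C0\<close>.\<close>
    proof (cases "X = Y")
      case True
      then show ?thesis
        using part[of X] XY \<open>p \<noteq> q\<close> by (auto simp: partition_on_def disjoint_def disjnt_def)
    next
      case False
      then have "X \<inter> Y = {}"
        using assms XY by (auto simp: partition_on_def disjoint_def)
      moreover have "p \<subseteq> X" "q \<subseteq> Y"
        using part XY by (auto simp: partition_on_def)
      ultimately show ?thesis
        by (auto simp: disjnt_def)
    qed
  qed
qed

text \<open>The atom through a point of \<open>C\<close> lies in some part, and that part meets
  \<open>C\<close>, hence is \<open>C\<close>. Sums over the atoms of a cluster thereby become sums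
  over its points.\<close>

lemma part_eq_Union_of_finer:
  assumes "partition_on V K" "partition_on V P" "\<forall>A\<in>K. \<exists>C\<in>P. A \<subseteq> C" "C \<in> P"
  shows "C = \<Union>{L \<in> K. L \<subseteq> C}"
proof
  show "C \<subseteq> \<Union>{L \<in> K. L \<subseteq> C}"
  proof
    fix x assume "x \<in> C"
    then obtain L where "L \<in> K" "x \<in> L"
      using assms(1,2,4) unfolding partition_on_def by blast
    moreover obtain D where "D \<in> P" "L \<subseteq> D"
      using assms(3) \<open>L \<in> K\<close> by blast
    moreover have "D = C"
      using assms(2,4) \<open>x \<in> C\<close> calculation by (auto simp: partition_on_def disjoint_def)
    ultimately show "x \<in> \<Union>{L \<in> K. L \<subseteq> C}" by blast
  qed
qed blast

section \<open>Averaged triangle inequalities and the volume of a cluster\<close>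

context cc_instance
begin

lemma weight_nonneg: "\<lbrakk>X \<subseteq> V; Y \<subseteq> V\<rbrakk> \<Longrightarrow> 0 \<le> weight w X Y"
  unfolding weight_def by (intro sum_nonneg w_nonneg) auto

lemma weight_sym: "\<lbrakk>X \<subseteq> V; Y \<subseteq> V\<rbrakk> \<Longrightarrow> weight w X Y = weight w Y X"
  unfolding weight_def by (subst sum.swap) (intro sum.cong refl w_sym; blast)

lemma pos_weight_le_weight:
  assumes "X \<subseteq> V" "Y \<subseteq> V"
  shows "pos_weight Ep w X Y \<le> weight w X Y"
  unfolding pos_weight_def weight_def
  using assms finite_subset[OF _ finite_V]
  by (intro sum_mono sum_mono2) (auto intro: w_nonneg)

text \<open>Sum the triangle inequality over all triples in \<open>X\<close>, \<open>Y\<close>,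
  \<open>Z\<close>: each term ignores one index and picks up the cardinality of that set. The sets
  may overlap or coincide; below this is used with \<open>X = Z\<close>.\<close>

lemma weight_triangle:
  assumes "X \<subseteq> V" "Y \<subseteq> V" "Z \<subseteq> V"
  shows "card Y * weight w X Z \<le> card Z * weight w X Y + card X * weight w Y Z"
proof -
  have "card Y * weight w X Z = (\<Sum>x\<in>X. \<Sum>z\<in>Z. \<Sum>y\<in>Y. w x z)"
    by (simp add: weight_def sum_distrib_left)
  also have "\<dots> \<le> (\<Sum>x\<in>X. \<Sum>z\<in>Z. \<Sum>y\<in>Y. w x y + w y z)"
    using assms by (intro sum_mono w_triangle) auto
  also have "\<dots> = (\<Sum>x\<in>X. \<Sum>z\<in>Z. \<Sum>y\<in>Y. w x y) + (\<Sum>x\<in>X. \<Sum>z\<in>Z. \<Sum>y\<in>Y. w y z)"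
    by (simp add: sum.distrib)
  also have "(\<Sum>x\<in>X. \<Sum>z\<in>Z. \<Sum>y\<in>Y. w y z) = card X * weight w Y Z"
    unfolding weight_def by (subst (2) sum.swap) simp
  also have "(\<Sum>x\<in>X. \<Sum>z\<in>Z. \<Sum>y\<in>Y. w x y) = card Z * weight w X Y"
    by (simp add: weight_def sum_distrib_left)
  finally show ?thesis .
qed

text \<open>The bracket is an upper bound for the volume. It equals twice the boundary weight of
  \<open>A\<close> plus the weight inside \<open>C - A\<close>; routing the latter through
  \<open>A\<close> costs \<open>2 * card (C - A)\<close> boundary weights, and the coefficients add
  up to \<open>2 * card C\<close>.\<close>

lemma card_mult_weight_le_boundary:
  assumes "A \<subseteq> C" "C \<subseteq> V"
  shows "card A * (weight w A (C - A) + weight w (C - A) C) \<le> 2 * card C * weight w A (C - A)"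
proof -
  have fin: "finite C" "finite A"
    using assms finite_subset[OF _ finite_V] by auto
  have "weight w (C - A) C = weight w (C - A) A + weight w (C - A) (C - A)"
    using weight_Un_right[of A "C - A" w "C - A"] fin assms by (simp add: Un_absorb1)
  moreover have sym: "weight w (C - A) A = weight w A (C - A)"
    using assms by (intro weight_sym) auto
  moreover have "card A * weight w (C - A) (C - A) \<le> 2 * card (C - A) * weight w A (C - A)"
    using weight_triangle[of "C - A" A "C - A"] sym assms by (simp add: subset_trans[of A C V] subset_trans[of "C - A" C V])
  moreover have "real (card (C - A)) = card C - real (card A)"
    using assms fin by (simp add: card_Diff_subset card_mono of_nat_diff)
  ultimately show ?thesis
    by (simp add: algebra_simps)
qed

text \<open>Only the points of the rest \<open>R\<close> need the triangle inequality. The shares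
  \<open>card A\<close> and \<open>card B\<close> of \<open>card C\<close> are paid by
  \<open>weight w A B\<close>, which is contained in both boundary weights.\<close>

lemma card_mult_weight_le_boundaries:
  assumes "A \<subseteq> C" "B \<subseteq> C" "A \<inter> B = {}" "C \<subseteq> V"
  shows "card C * weight w A B \<le> card B * weight w A (C - A) + card A * weight w B (C - B)"
proof -
  define R where "R = C - A - B"
  have fin: "finite A" "finite B" "finite R"
    using assms finite_subset[OF _ finite_V] by (auto simp: R_def)
  have CA: "C - A = B \<union> R" and CB: "C - B = A \<union> R" and C: "C = A \<union> (B \<union> R)"
    using assms by (auto simp: R_def)
  have disj: "B \<inter> R = {}" "A \<inter> R = {}" "A \<inter> (B \<union> R) = {}"
    using assms by (auto simp: R_def)
  have "card C = card A + (card B + card R)"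
    unfolding C using fin disj by (simp add: card_Un_disjoint)
  moreover have "weight w A (C - A) = weight w A B + weight w A R"
    unfolding CA using fin disj by (simp add: weight_Un_right)
  moreover have "weight w B (C - B) = weight w B A + weight w B R"
    unfolding CB using fin disj by (simp add: weight_Un_right)
  moreover have "weight w B A = weight w A B" "weight w B R = weight w R B"
    using assms by (auto intro!: weight_sym simp: R_def)
  moreover have "card R * weight w A B \<le> card B * weight w A R + card A * weight w R B"
    using assms by (intro weight_triangle) (auto simp: R_def)
  ultimately show ?thesis
    by (simp add: algebra_simps)
qed

text \<open>The atom \<open>A\<close> is treated apart: its degree is bounded by its boundary
  weight, so that no weight inside \<open>A\<close> enters, since averaging through \<open>A\<close>
  would not control it. For the other atoms the internal weight is added generously, and their
  bounds sum to \<open>weight w (C - A) C\<close>.\<close>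

lemma cluster_vol_le_weight:
  assumes disj: "disjoint K" and C: "C = \<Union>{L \<in> K. L \<subseteq> C}" "C \<subseteq> V"
    and A: "A \<in> K" "A \<subseteq> C"
    and deg: "\<And>L. \<lbrakk>L \<in> K; L \<subseteq> C\<rbrakk> \<Longrightarrow> atom_degree K Ep w C L \<le> weight w L (C - L)"
  shows "cluster_vol K Ep w C \<le> weight w A (C - A) + weight w (C - A) C"
proof -
  let ?F = "{L \<in> K. L \<subseteq> C}"
  have finC: "finite C"
    using C(2) finite_V by (rule finite_subset)
  have finF: "finite ?F"
    using finC by (auto intro: finite_subset[of _ "Pow C"])
  have CA: "C - A = \<Union>(?F - {A})"
  proof
    show "C - A \<subseteq> \<Union>(?F - {A})" using C(1) by blast
    show "\<Union>(?F - {A}) \<subseteq> C - A" using disj A(1) unfolding disjoint_def by blast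
  qed
  have "cluster_vol K Ep w C
      = atom_degree K Ep w C A + (\<Sum>L\<in>?F - {A}. atom_degree K Ep w C L)"
    unfolding cluster_vol_def using A finF by (intro sum.remove) auto
  also have "(\<Sum>L\<in>?F - {A}. atom_degree K Ep w C L) \<le> (\<Sum>L\<in>?F - {A}. weight w L C)"
  proof (rule sum_mono)
    fix L assume L: "L \<in> ?F - {A}"
    then have "weight w L C = weight w L (C - L) + weight w L L"
      using weight_Un_right[of "C - L" L w L] finC finite_subset[OF _ finC, of L]
      by (simp add: Un_absorb2 Int_commute)
    moreover have "0 \<le> weight w L L"
      using L C(2) by (intro weight_nonneg) auto
    ultimately show "atom_degree K Ep w C L \<le> weight w L C"
      using deg[of L] L by simp
  qed
  also have "(\<Sum>L\<in>?F - {A}. weight w L C) = weight w (C - A) C"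
    unfolding CA using disj finite_subset[OF _ finC]
    by (subst weight_Union_left) (auto simp: disjoint_def)
  finally show ?thesis
    using deg[of A] A by simp
qed

end

section \<open>Combining the averaged bounds with regularity\<close>

theorem claim3p7:
  fixes V :: "'a set" and Ep Em :: "'a set set" and w :: "'a \<Rightarrow> 'a \<Rightarrow> real"
    and \<alpha> \<beta> \<epsilon> :: real and C0 K C1 :: "'a set set" and C A B :: "'a set"
  assumes "cc_instance V Ep Em w"
    and "0 < \<beta>" and "\<beta> \<le> (2 * sqrt 7 - 5) / 6"
    and "partition_on V C0" and "obj Ep Em w C0 \<le> 20 / 3 * opt V Ep Em w"
    and "K = atoms \<beta> Ep w C0"
    and "atom_cost_constant \<beta> \<alpha>"
    and "0 < \<epsilon>" and "\<epsilon> \<le> 1"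
    and "regular_clustering V Ep Em w K \<alpha> \<epsilon> C1"
    and "C \<in> C1" and "2 \<le> card {L \<in> K. L \<subseteq> C}"
    and "A \<in> K" and "A \<subseteq> C" and "B \<in> K" and "B \<subseteq> C" and "A \<noteq> B"
  shows "weight w A B
    < 32 * (atom_degree K Ep w C A * atom_degree K Ep w C B / cluster_vol K Ep w C)"
proof -
  interpret cc_instance V Ep Em w by fact
  have reg: "partition_on V C1" "\<forall>A\<in>K. \<exists>C\<in>C1. A \<subseteq> C"
    and R1: "\<And>S T. \<lbrakk>S \<union> T = C; S \<inter> T = {}; S \<noteq> {}; T \<noteq> {}; atom_union K S; atom_union K T\<rbrakk>
      \<Longrightarrow> pos_weight Ep w S T > 1 / 2 * weight w S T"
    using assms(10,11) unfolding regular_clustering_def by blast+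
  have K: "partition_on V K"
    using assms(4,6) partition_on_atoms by blast
  then have disjK: "disjoint K"
    by (simp add: partition_on_def)
  have C: "C = \<Union>{L \<in> K. L \<subseteq> C}"
    using K reg assms(11) by (rule part_eq_Union_of_finer)
  have CV: "C \<subseteq> V"
    using reg(1) assms(11) by (auto simp: partition_on_def)
  have finC: "finite C"
    using CV finite_V by (rule finite_subset)
  have AB: "A \<inter> B = {}" and ne: "A \<noteq> {}" "B \<noteq> {}"
    using disjK K assms(13,15,17) by (auto simp: disjoint_def partition_on_def)

  let ?d = "atom_degree K Ep w C" and ?D = "\<lambda>L. weight w L (C - L)"
    and ?vol = "cluster_vol K Ep w C"
  have compl: "C - L = \<Union>{M \<in> K. M \<subseteq> C \<and> M \<noteq> L}" if "L \<in> K" for L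
  proof
    show "C - L \<subseteq> \<Union>{M \<in> K. M \<subseteq> C \<and> M \<noteq> L}" using C by blast
    show "\<Union>{M \<in> K. M \<subseteq> C \<and> M \<noteq> L} \<subseteq> C - L"
      using disjK that unfolding disjoint_def by blast
  qed
  \<comment> \<open>The other atoms of \<open>C\<close> tile \<open>C - L\<close>, so the degree is
    the positive weight of the cut that (R1) speaks about.\<close>
  have d_eq: "?d L = pos_weight Ep w L (C - L)" if "L \<in> K" for L
    unfolding compl[OF that] atom_degree_def using disjK finC
    by (subst pos_weight_Union_right)
      (auto simp: disjoint_def intro: finite_subset[of _ "Pow C"] finite_subset[of _ C])
  have d_le: "?d L \<le> ?D L" if "L \<in> K" "L \<subseteq> C" for L
    using d_eq that CV by (auto intro!: pos_weight_le_weight)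
  have D_less: "?D L < 2 * ?d L" if "L \<in> K" "L \<subseteq> C" "C - L \<noteq> {}" for L
  proof -
    have "atom_union K L"
      unfolding atom_union_def using that by (intro exI[of _ "{L}"]) auto
    moreover have "atom_union K (C - L)"
      unfolding atom_union_def using compl[OF that(1)]
      by (intro exI[of _ "{M \<in> K. M \<subseteq> C \<and> M \<noteq> L}"]) auto
    moreover have "L \<noteq> {}"
      using that K by (auto simp: partition_on_def)
    ultimately show ?thesis
      using R1[of L "C - L"] that d_eq by (simp add: Un_absorb1)
  qed
  have D_nonneg: "0 \<le> ?D L" if "L \<subseteq> C" for L
    using that CV by (intro weight_nonneg) auto
  \<comment> \<open>Both complements are nonempty: \<open>C - A\<close> contains \<open>B\<close>,
    and \<open>C - B\<close> contains \<open>A\<close>.\<close>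
  have less: "?D A < 2 * ?d A" "?D B < 2 * ?d B"
    by (rule D_less; use AB ne assms(13-16) in blast)+
  \<comment> \<open>Strictness in (R1) together with nonnegative boundary weights forces positive
    degrees; the volume is then positive as well, being at least \<open>?d A\<close>.\<close>
  then have pos: "0 < ?d A" "0 < ?d B"
    using D_nonneg[of A] D_nonneg[of B] assms(14,16) by auto

  have d_nonneg: "0 \<le> ?d L" if "L \<in> K" "L \<subseteq> C" for L
    unfolding atom_degree_def pos_weight_def using that CV
    by (intro sum_nonneg w_nonneg) auto
  have "?d A \<le> ?vol"
    unfolding cluster_vol_def using assms(13,14) d_nonneg finC
    by (intro member_le_sum) (auto intro: finite_subset[of _ "Pow C"])
  then have vol_pos: "0 < ?vol"
    using pos by simp
  have vol_le: "card L * ?vol \<le> 2 * card C * ?D L" if "L \<in> K" "L \<subseteq> C" for L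
    using mult_left_mono[OF cluster_vol_le_weight[OF disjK C CV that d_le], of "card L"]
      card_mult_weight_le_boundary[OF that(2) CV] by linarith

  have "card C * (weight w A B * ?vol) \<le> (card B * ?D A + card A * ?D B) * ?vol"
    using mult_right_mono[OF card_mult_weight_le_boundaries[OF assms(14,16) AB CV], of ?vol] vol_pos
    by (simp add: mult.assoc)
  also have "\<dots> = ?D A * (card B * ?vol) + ?D B * (card A * ?vol)"
    by (simp add: algebra_simps)
  \<comment> \<open>The volume bound is used crosswise, for \<open>B\<close> in the first summand
    and for \<open>A\<close> in the second, so both become the same product.\<close>
  also have "\<dots> \<le> ?D A * (2 * card C * ?D B) + ?D B * (2 * card C * ?D A)"
    using vol_le D_nonneg assms(13-16) by (intro add_mono mult_left_mono) auto
  also have "\<dots> = card C * (4 * (?D A * ?D B))"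
    by (simp add: algebra_simps)
  finally have "weight w A B * ?vol \<le> 4 * (?D A * ?D B)"
  proof (rule mult_left_le_imp_le)
    show "0 < real (card C)"
      using finC ne(1) assms(14) by (auto simp: card_gt_0_iff)
  qed
  also have "\<dots> \<le> 4 * ((2 * ?d A) * (2 * ?d B))"
    using less D_nonneg assms(14,16) pos by (intro mult_left_mono mult_mono) auto
  \<comment> \<open>The left side is 16 times the product of the degrees; this product is positive,
    so the larger constant gives strictness.\<close>
  also have "\<dots> < 32 * (?d A * ?d B)"
    using mult_pos_pos[OF pos] by simp
  finally show ?thesis
    using vol_pos by (simp add: field_simps)
qed

end
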